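(* Let $\ell\ge 4$ be even and $m\ge 1$ odd with $\ell+m\equiv 1\pmod 4$. Then there exists an $\mathcal{AL}\!\left(\frac{\ell+m-1}{4},\,3\cdot\frac{\ell+m-1}{4}+1\right)$ of $[\ell\mid m]$ whenever either $m\in\{1,3\}$ and $\ell\ge 8$, or $m\ge \ell+5$.
   Context: $\mathcal{I}(a,b)=\{x\in\mathbb{Z}\mid a\le x\le b\}$. $[\ell\mid m]$ is the vertex-disjoint union of an $\ell$-cycle and a path with $m$ edges; its number of edges is $\epsilon=\ell+m$. A labeling is an isomorphic copy with distinct integer vertices; $\Delta\Gamma$ is the multiset of differences $x-y$ over ordered pairs of adjacent vertices. An $\mathcal{AL}(x,y)$ ($\alpha$-labeling with path ends $x,y$) of a bipartite graph of this type with $\epsilon$ edges is a labeling $\Gamma$ with vertex set $\mathcal{I}(0,\epsilon)$ such that every edge joins a vertex of $\mathcal{I}(0,\lfloor(\epsilon-1)/2\rfloor)$ to a vertex of $\mathcal{I}(\lfloor(\epsilon+1)/2\rfloor,\epsilon)$, the end-vertices of the path are $x$ and $y$, and $\Delta\Gamma=\pm\mathcal{I}(1,\epsilon)$. *)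

theory Defs
  imports "HOL-Library.Multiset" "HOL-Number_Theory.Cong"
begin

(* Simple undirected graphs; an edge is the two-element set of its endpoints. *)
record 'a ugraph =
  verts :: "'a set"
  edges :: "'a set set"

(* Only meaningful for n >= 3. *)
definition cycle_graph :: "nat \<Rightarrow> nat ugraph" where
  "cycle_graph n = \<lparr> verts = {..<n}, edges = {{i, (i + 1) mod n} | i. i < n} \<rparr>"

(* The parameter counts edges, so the path has m + 1 vertices, with end-vertices 0 and m. *)
definition path_graph :: "nat \<Rightarrow> nat ugraph" where
  "path_graph m = \<lparr> verts = {..m}, edges = {{i, i + 1} | i. i < m} \<rparr>"

definition disjoint_union :: "'a ugraph \<Rightarrow> 'b ugraph \<Rightarrow> ('a + 'b) ugraph" where
  "disjoint_union G H =
     \<lparr> verts = verts G <+> verts H,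
       edges = (`) Inl ` edges G \<union> (`) Inr ` edges H \<rparr>"

(* The graph [l | m]. *)
definition cycle_path :: "nat \<Rightarrow> nat \<Rightarrow> (nat + nat) ugraph" where
  "cycle_path l m = disjoint_union (cycle_graph l) (path_graph m)"

definition graph_iso :: "('a \<Rightarrow> 'b) \<Rightarrow> 'a ugraph \<Rightarrow> 'b ugraph \<Rightarrow> bool" where
  "graph_iso f G H \<longleftrightarrow> bij_betw f (verts G) (verts H) \<and> edges H = (`) f ` edges G"

(* The multiset Delta of differences over ordered pairs of adjacent vertices: every edge
   contributes both x - y and y - x.  For a graph with infinitely many edges it is empty. *)
definition difference_mset :: "int ugraph \<Rightarrow> int multiset" where
  "difference_mset \<Gamma> = {# x - y. (x, y) \<in># mset_set {(x, y). {x, y} \<in> edges \<Gamma>} #}"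

(* \<Gamma> is an AL(x, y) of [l | m].  The end-vertices of the path in the copy \<Gamma> are
   the images of the end-vertices Inr 0 and Inr m of the path in [l | m].  On integers, div
   rounds towards minus infinity, which gives the floors. *)
definition is_AL :: "nat \<Rightarrow> nat \<Rightarrow> int \<Rightarrow> int \<Rightarrow> int ugraph \<Rightarrow> bool" where
  "is_AL l m x y \<Gamma> \<longleftrightarrow>
     (let \<epsilon> = int (l + m) in
        (\<exists>f. graph_iso f (cycle_path l m) \<Gamma> \<and> {f (Inr 0), f (Inr m)} = {x, y}) \<and>
        verts \<Gamma> = {0..\<epsilon>} \<and>
        (\<forall>e \<in> edges \<Gamma>. \<exists>a \<in> {0..(\<epsilon> - 1) div 2}. \<exists>b \<in> {(\<epsilon> + 1) div 2..\<epsilon>}. e = {a, b}) \<and>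
        difference_mset \<Gamma> = mset_set ({1..\<epsilon>} \<union> uminus ` {1..\<epsilon>}))"

end

theory Submission
  imports Defs
begin

text \<open>
  Let \<open>l + m = 4k + 1\<close>. Write a vertex of the lower half as \<open>a + k\<close> and one of the upper half as
  \<open>3k + 1 - b\<close> with \<open>a, b\<close> in \<open>-k..k\<close>. An edge then has difference \<open>2k + 1 - (a + b)\<close>, so an
  \<open>\<alpha>\<close>-labeling is a graph on two copies of \<open>-k..k\<close> whose edge sums \<open>a + b\<close> are exactly \<open>-2k..2k\<close>,
  and the path has to join the two zeros.

  Suppose that such a labeling with half-width \<open>c\<close> has a path edge of sum \<open>0\<close> joining \<open>y\<close> to \<open>-y\<close>.
  This edge can be replaced by \<open>y, u, -rev u, -y\<close>, where \<open>u\<close> is a path that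
  uses all of \<open>-c-s..-c-1\<close> on both sides, has consecutive distinct sums and starts at \<open>-2c-1-y\<close>. The
  result has half-width \<open>c + s\<close> and a path with \<open>4s\<close> more edges. Paths such as \<open>u\<close> exist for every
  prescribed starting point (Abrham), by cutting off zigzag blocks as in the Euclidean algorithm.
  Hence the cases \<open>m = 1\<close> and \<open>m = 3\<close>, where a single zigzag and one Abrham path (with a few extra
  vertices if \<open>m = 3\<close>) form the cycle, yield all \<open>m \<ge> l + 5\<close> as soon as \<open>l \<ge> 8\<close>. For
  \<open>l = 4\<close> and \<open>l = 6\<close>, and for \<open>m = 3\<close> with \<open>l \<le> 18\<close>, the labelings were found by computer search.
\<close>

section \<open>Alternating lists\<close>

text \<open>
  A walk in a bipartite graph is given by the list of its vertices. Since the walk alternates between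
  the two sides, the entries at even and at odd positions are the vertices on the two sides.
\<close>

fun evens :: "'a list \<Rightarrow> 'a set" and odds :: "'a list \<Rightarrow> 'a set" where
  "evens [] = {}"
| "evens (x # xs) = insert x (odds xs)"
| "odds [] = {}"
| "odds (x # xs) = evens xs"

text \<open>A set is enough: repeated sums are excluded later by counting edges.\<close>

fun adj_sums :: "int list \<Rightarrow> int set" where
  "adj_sums (x # y # zs) = insert (x + y) (adj_sums (y # zs))"
| "adj_sums _ = {}"

text \<open>Translates the two sides independently; swapping the arguments in the recursive call
  keeps \<open>a\<close> on the even positions.\<close>

fun shift :: "int \<Rightarrow> int \<Rightarrow> int list \<Rightarrow> int list" where
  "shift a b [] = []"
| "shift a b (x # xs) = (x + a) # shift b a xs"

lemma evens_odds_iff_nth: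
  "(x \<in> evens xs \<longleftrightarrow> (\<exists>i < length xs. even i \<and> xs ! i = x)) \<and>
   (x \<in> odds xs \<longleftrightarrow> (\<exists>i < length xs. odd i \<and> xs ! i = x))"
proof (induction xs)
  case (Cons y ys)
  have "(\<exists>i < length (y # ys). even i \<and> (y # ys) ! i = x) \<longleftrightarrow>
      y = x \<or> (\<exists>i < length ys. odd i \<and> ys ! i = x)"
    by (simp add: Ex_less_Suc2)
  moreover have "(\<exists>i < length (y # ys). odd i \<and> (y # ys) ! i = x) \<longleftrightarrow>
      (\<exists>i < length ys. even i \<and> ys ! i = x)"
    by (simp add: Ex_less_Suc2)
  ultimately show ?case using Cons by auto
qed simp

lemmas evens_iff_nth = evens_odds_iff_nth[THEN conjunct1]
  and odds_iff_nth = evens_odds_iff_nth[THEN conjunct2]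

lemma ex_nat_iff: "(\<exists>i. P i) \<longleftrightarrow> P 0 \<or> (\<exists>i. P (Suc i))"
  by (metis not0_implies_Suc)

lemma adj_sums_iff_nth:
  "s \<in> adj_sums xs \<longleftrightarrow> (\<exists>i. Suc i < length xs \<and> xs ! i + xs ! Suc i = s)"
proof (induction xs rule: adj_sums.induct)
  case (1 x y zs)
  have "(\<exists>i. Suc i < length (x # y # zs) \<and> (x # y # zs) ! i + (x # y # zs) ! Suc i = s) \<longleftrightarrow>
      x + y = s \<or> (\<exists>i. Suc i < length (y # zs) \<and> (y # zs) ! i + (y # zs) ! Suc i = s)"
    by (subst ex_nat_iff) auto
  then show ?case using 1 by auto
qed auto

section \<open>Walks under concatenation, reversal, translation and negation\<close>

lemma evens_odds_append:
  "evens (xs @ ys) = evens xs \<union> (if even (length xs) then evens ys else odds ys) \<and>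
   odds (xs @ ys) = odds xs \<union> (if even (length xs) then odds ys else evens ys)"
  by (induction xs) auto

lemmas evens_append = evens_odds_append[THEN conjunct1]
  and odds_append = evens_odds_append[THEN conjunct2]

lemma evens_rev: "evens (rev xs) = (if even (length xs) then odds xs else evens xs)"
  and odds_rev: "odds (rev xs) = (if even (length xs) then evens xs else odds xs)"
  by (induction xs) (auto simp: evens_append odds_append)

lemma evens_odds_shift:
  "(x \<in> evens (shift a b xs) \<longleftrightarrow> x - a \<in> evens xs) \<and>
   (x \<in> odds (shift a b xs) \<longleftrightarrow> x - b \<in> odds xs)"
  by (induction a b xs rule: shift.induct) auto

lemma evens_odds_uminus:
  "(x \<in> evens (map uminus xs) \<longleftrightarrow> - x \<in> evens xs) \<and>
   (x \<in> odds (map uminus xs) \<longleftrightarrow> - x \<in> odds xs)" for x :: int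
  by (induction xs) auto

lemma adj_sums_append:
  assumes "xs \<noteq> []" "ys \<noteq> []"
  shows "adj_sums (xs @ ys) = insert (last xs + hd ys) (adj_sums xs \<union> adj_sums ys)"
  using assms
proof (induction xs rule: adj_sums.induct)
  case ("2_2" v)
  then show ?case by (cases ys) auto
qed auto

lemma adj_sums_rev: "adj_sums (rev xs) = adj_sums xs"
proof (induction xs rule: adj_sums.induct)
  case (1 x y zs)
  have "adj_sums (rev (y # zs) @ [x]) = insert (y + x) (adj_sums (y # zs))"
    using 1 by (subst adj_sums_append) (auto simp: last_rev)
  then show ?case by (simp add: add.commute)
qed auto

lemma adj_sums_shift: "x \<in> adj_sums (shift a b xs) \<longleftrightarrow> x - a - b \<in> adj_sums xs"
proof (induction xs arbitrary: a b rule: adj_sums.induct)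
  case (1 u v zs)
  from "1.IH"[of b a] show ?case by (auto simp: algebra_simps)
qed auto

lemma adj_sums_uminus: "x \<in> adj_sums (map uminus xs) \<longleftrightarrow> - x \<in> adj_sums xs"
  by (induction xs rule: adj_sums.induct) auto

lemma length_shift [simp]: "length (shift a b xs) = length xs"
  by (induction a b xs rule: shift.induct) auto

lemma shift_eq_Nil [simp]: "shift a b xs = [] \<longleftrightarrow> xs = []"
  by (cases xs) auto

lemma hd_shift: "xs \<noteq> [] \<Longrightarrow> hd (shift a b xs) = hd xs + a"
  by (cases xs) auto

lemma last_shift:
  "xs \<noteq> [] \<Longrightarrow> last (shift a b xs) = last xs + (if even (length xs) then b else a)"
  by (induction a b xs rule: shift.induct) auto

lemmas walk_simps = evens_append odds_append evens_rev odds_rev adj_sums_append adj_sums_rev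
  hd_shift last_shift hd_rev last_rev hd_map last_map

lemmas mem_simps = evens_odds_shift evens_odds_uminus adj_sums_shift adj_sums_uminus

section \<open>Paths with consecutive edge sums\<close>

text \<open>Replacing the vertices b of one side by a constant minus b turns these sums into
  differences, so this encodes an \<alpha>-labeling of a path. The length condition forces distinct
  entries on each side.\<close>

definition alpha_path :: "int \<Rightarrow> int \<Rightarrow> int list \<Rightarrow> bool" where
  "alpha_path p q xs \<longleftrightarrow> 0 \<le> p \<and> 0 \<le> q \<and> evens xs = {0..<p} \<and> odds xs = {0..<q} \<and>
     adj_sums xs = {0..<p + q - 1} \<and> int (length xs) = p + q"

lemma alpha_pathI:
  assumes "0 \<le> p" "0 \<le> q" "\<And>x. x \<in> evens xs \<longleftrightarrow> 0 \<le> x \<and> x < p"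
    "\<And>x. x \<in> odds xs \<longleftrightarrow> 0 \<le> x \<and> x < q" "\<And>x. x \<in> adj_sums xs \<longleftrightarrow> 0 \<le> x \<and> x < p + q - 1"
    "int (length xs) = p + q"
  shows "alpha_path p q xs"
  using assms by (auto simp: alpha_path_def)

lemma alpha_pathD:
  assumes "alpha_path p q xs"
  shows "0 \<le> p" "0 \<le> q" "x \<in> evens xs \<longleftrightarrow> 0 \<le> x \<and> x < p"
    "x \<in> odds xs \<longleftrightarrow> 0 \<le> x \<and> x < q" "x \<in> adj_sums xs \<longleftrightarrow> 0 \<le> x \<and> x < p + q - 1"
    "int (length xs) = p + q"
  using assms by (auto simp: alpha_path_def)

lemma alpha_path_length_parity:
  assumes "alpha_path p q xs"
  shows "even (length xs) \<longleftrightarrow> even (p + q)"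
  using assms unfolding alpha_path_def by presburger

lemma alpha_path_nonempty: "alpha_path p q xs \<Longrightarrow> p + q > 0 \<Longrightarrow> xs \<noteq> []"
  by (auto simp: alpha_path_def)

text \<open>The sums of \<open>xs\<close> end at 2n - 2 and the translated sums of \<open>ys\<close>
  start at 2n; the linking edge supplies 2n - 1.\<close>

lemma alpha_path_append_even:
  assumes xs: "alpha_path n n xs" and ys: "alpha_path p q ys" and "n > 0" "p + q > 0"
    and link: "last xs + hd ys = n - 1"
  shows "alpha_path (n + p) (n + q) (xs @ shift n n ys)"
proof -
  have "xs \<noteq> []" "ys \<noteq> []" using assms alpha_path_nonempty by auto
  moreover have "even (length xs)"
    using alpha_path_length_parity[OF xs] by simp
  moreover have "last xs = n - 1 - hd ys" using link by simp
  ultimately show ?thesis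
    using \<open>n > 0\<close> \<open>p + q > 0\<close> alpha_pathD[OF xs] alpha_pathD[OF ys]
    by (intro alpha_pathI) (auto simp: walk_simps mem_simps)
qed

text \<open>An odd first block makes \<open>ys\<close> start on the other side, so \<open>p\<close>
  and \<open>q\<close> change places. The linking edge supplies the missing sum 2n.\<close>

lemma alpha_path_append_odd:
  assumes xs: "alpha_path (n + 1) n xs" and ys: "alpha_path p q ys" and "p + q > 0"
    and link: "last xs + hd ys = n"
  shows "alpha_path (n + 1 + q) (n + p) (xs @ shift n (n + 1) ys)"
proof -
  have "n \<ge> 0" using xs by (simp add: alpha_path_def)
  then have "xs \<noteq> []" "ys \<noteq> []" using assms alpha_path_nonempty by auto
  moreover have "odd (length xs)"
    using alpha_path_length_parity[OF xs] by simp
  moreover have "last xs = n - hd ys" using link by simp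
  ultimately show ?thesis
    using \<open>p + q > 0\<close> alpha_pathD[OF xs] alpha_pathD[OF ys]
    by (intro alpha_pathI) (auto simp: walk_simps mem_simps)
qed

text \<open>A sum s becomes p + q - 2 - s, so the required sums are permuted.\<close>

lemma alpha_path_reflect:
  assumes "alpha_path p q xs"
  shows "alpha_path p q (shift (p - 1) (q - 1) (map uminus xs))"
  using alpha_pathD[OF assms] by (intro alpha_pathI) (auto simp: mem_simps)

text \<open>The path is 0, 0, 1, 1, 2, 2, ..., whose sums increase by one at each step.\<close>

lemma zigzag_even:
  assumes "n \<ge> 1"
  shows "\<exists>xs. alpha_path n n xs \<and> hd xs = 0 \<and> last xs = n - 1"
  using assms
proof (induction n rule: int_ge_induct)
  case base
  have "alpha_path 1 1 [0, 0]" by (auto simp: alpha_path_def)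
  then show ?case by (intro exI[of _ "[0, 0]"]) simp
next
  case (step n)
  then obtain xs where xs: "alpha_path n n xs" "hd xs = 0" "last xs = n - 1" by blast
  have "alpha_path 1 1 [0, 0]" by (auto simp: alpha_path_def)
  then have "alpha_path (n + 1) (n + 1) (xs @ shift n n [0, 0])"
    using xs step.hyps by (intro alpha_path_append_even) auto
  moreover have "xs \<noteq> []" using xs step.hyps alpha_path_nonempty by auto
  ultimately show ?case using xs by (intro exI[of _ "xs @ shift n n [0, 0]"]) simp
qed

lemma zigzag_odd:
  assumes "n \<ge> 0"
  shows "\<exists>xs. alpha_path (n + 1) n xs \<and> hd xs = 0 \<and> last xs = n"
proof (cases "n = 0")
  case True
  then show ?thesis by (intro exI[of _ "[0]"]) (auto simp: alpha_path_def)
next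
  case False
  then obtain xs where xs: "alpha_path n n xs" "hd xs = 0" "last xs = n - 1"
    using zigzag_even[of n] assms by auto
  have "alpha_path 1 0 [0]" by (auto simp: alpha_path_def)
  then have "alpha_path (n + 1) (n + 0) (xs @ shift n n [0])"
    using xs assms False by (intro alpha_path_append_even) auto
  moreover have "xs \<noteq> []" using xs assms False alpha_path_nonempty by auto
  ultimately show ?thesis using xs by (intro exI[of _ "xs @ shift n n [0]"]) simp
qed

lemma zigzag_even_down:
  assumes "n \<ge> 1"
  shows "\<exists>xs. alpha_path n n xs \<and> hd xs = n - 1 \<and> last xs = 0"
proof -
  obtain xs where xs: "alpha_path n n xs" "hd xs = 0" "last xs = n - 1"
    using zigzag_even assms by blast
  moreover have "xs \<noteq> []" using xs assms alpha_path_nonempty by auto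
  ultimately show ?thesis
    by (intro exI[of _ "shift (n - 1) (n - 1) (map uminus xs)"])
      (auto simp: alpha_path_reflect walk_simps)
qed

lemma zigzag_odd_down:
  assumes "n \<ge> 0"
  shows "\<exists>xs. alpha_path (n + 1) n xs \<and> hd xs = n \<and> last xs = 0"
proof -
  obtain xs where xs: "alpha_path (n + 1) n xs" "hd xs = 0" "last xs = n"
    using zigzag_odd assms by blast
  moreover have "xs \<noteq> []" using xs assms alpha_path_nonempty by auto
  ultimately show ?thesis
    using alpha_path_reflect[OF xs(1)] alpha_path_length_parity[OF xs(1)]
    by (intro exI[of _ "shift n (n - 1) (map uminus xs)"]) (auto simp: walk_simps)
qed

text \<open>Abrham's paths. Carrying the last vertex along lets the induction follow the end of the
  path through each appended block.\<close>

lemma alpha_path_starting_at: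
  assumes "1 \<le> z" "z \<le> r"
  shows "\<exists>xs. alpha_path r r xs \<and> hd xs = z - 1 \<and> last xs = r - z"
  using assms
proof (induction "nat r" arbitrary: r z rule: less_induct)
  case less
  \<comment> \<open>A zigzag on the first \<open>z\<close> vertices of each side leaves the same starting position in the rest.\<close>
  have small: "\<exists>xs. alpha_path r r xs \<and> hd xs = z - 1 \<and> last xs = r - z"
    if z: "1 \<le> z" "2 * z \<le> r" for z
  proof -
    obtain xs where xs: "alpha_path z z xs" "hd xs = z - 1" "last xs = 0"
      using zigzag_even_down z by blast
    obtain ys where ys: "alpha_path (r - z) (r - z) ys" "hd ys = z - 1" "last ys = r - z - z"
      using less.hyps[of "r - z" z] z by auto
    have "alpha_path (z + (r - z)) (z + (r - z)) (xs @ shift z z ys)"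
      using xs ys z by (intro alpha_path_append_even) auto
    moreover have "xs \<noteq> []" "ys \<noteq> []" using xs ys z alpha_path_nonempty by auto
    ultimately show ?thesis
      using xs ys by (intro exI[of _ "xs @ shift z z ys"]) (simp add: last_shift)
  qed
  \<comment> \<open>Reflection exchanges \<open>z\<close> and \<open>r + 1 - z\<close>, which
    reduces large \<open>z\<close> to \<open>small\<close>; its fixed point
    \<open>r = 2 * z - 1\<close> needs its own construction.\<close>
  have "2 * z \<le> r \<or> z = r \<or> r = 2 * z - 1 \<or> 2 * (r + 1 - z) \<le> r \<and> z < r"
    using less.prems by presburger
  then consider "2 * z \<le> r" | "z = r" | "r = 2 * z - 1" | "2 * (r + 1 - z) \<le> r" "z < r"
    by blast
  then show ?case
  proof cases
    case 1
    then show ?thesis using small less.prems by blast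
  next
    case 2
    then show ?thesis using zigzag_even_down less.prems by simp
  next
    case 3
    \<comment> \<open>Two copies of one descending zigzag, the second with its sides interchanged:
      it ends at 0 and starts at \<open>z - 1\<close>, as the link demands.\<close>
    obtain xs where xs: "alpha_path (z - 1 + 1) (z - 1) xs" "hd xs = z - 1" "last xs = 0"
      using zigzag_odd_down[of "z - 1"] less.prems by auto
    have "alpha_path (z - 1 + 1 + (z - 1)) (z - 1 + (z - 1 + 1))
        (xs @ shift (z - 1) (z - 1 + 1) xs)"
      using xs less.prems by (intro alpha_path_append_odd) auto
    moreover have "xs \<noteq> []" using xs less.prems alpha_path_nonempty by auto
    moreover have "odd (length xs)" using alpha_path_length_parity[OF xs(1)] by simp
    ultimately show ?thesis
      using xs 3 by (intro exI[of _ "xs @ shift (z - 1) z xs"]) (simp add: last_shift)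
  next
    case 4
    then obtain xs where xs: "alpha_path r r xs" "hd xs = r - z" "last xs = z - 1"
      using small[of "r + 1 - z"] by auto
    moreover have "xs \<noteq> []" using xs less.prems alpha_path_nonempty by auto
    ultimately show ?thesis
      using less.prems
      by (intro exI[of _ "shift (r - 1) (r - 1) (map uminus xs)"])
        (auto simp: alpha_path_reflect walk_simps)
  qed
qed

section \<open>Centred labelings\<close>

text \<open>The cycle closes through the edge from \<open>last cs\<close> to \<open>hd cs\<close>.
  Distinctness is implicit: 4k + 2 entries cover 4k + 2 vertices, and 4k + 1 edges cover 4k + 1
  sums.\<close>

definition centred_labelling :: "int \<Rightarrow> nat \<Rightarrow> nat \<Rightarrow> int list \<Rightarrow> int list \<Rightarrow> bool" where
  "centred_labelling k l m cs ps \<longleftrightarrow>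
     even l \<and> odd m \<and> int (l + m) = 4 * k + 1 \<and> length cs = l \<and> length ps = m + 1 \<and>
     evens cs \<union> evens ps = {-k..k} \<and> odds cs \<union> odds ps = {-k..k} \<and>
     insert (last cs + hd cs) (adj_sums cs) \<union> adj_sums ps = {-2 * k..2 * k} \<and>
     hd ps = 0 \<and> last ps = 0"

text \<open>The two halves of the inserted path have the sums below -2c - 1 and above 2c + 1; its
  links to \<open>y\<close> and \<open>-y\<close> give these two values, and its middle edge
  restores the sum 0 of the removed edge.\<close>

lemma centred_labelling_extend:
  assumes lab: "centred_labelling c l m cs (ps @ qs)" and ne: "ps \<noteq> []" "qs \<noteq> []"
    and ends: "last ps = y" "hd qs = - y" and y: "- c \<le> y" "c + y < s"
  shows "\<exists>rs. centred_labelling (c + s) l (m + 4 * nat s) cs rs"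
proof -
  \<comment> \<open>After translation by -c - s this start becomes -2c - 1 - y. The bounds on
    \<open>y\<close> say exactly that it is an admissible start.\<close>
  obtain us where us: "alpha_path s s us" "hd us = s - c - y - 1"
    using alpha_path_starting_at[of "s - c - y" s] y by auto
  have us_ne: "us \<noteq> []" and ev: "even (length us)"
    using us y alpha_path_nonempty alpha_path_length_parity[OF us(1)] lab
    by (auto simp: centred_labelling_def)
  define vs where "vs = shift (- c - s) (- c - s) us"
  define ws where "ws = vs @ rev (map uminus vs)"
  have ws: "ws \<noteq> []" "even (length ws)" "hd ws = - 2 * c - y - 1" "last ws = 2 * c + y + 1"
    using us us_ne ev by (auto simp: ws_def vs_def walk_simps)
  have "c \<ge> 0" "s > 0" using lab y by (auto simp: centred_labelling_def)
  define R where "R = {-c - s..<-c} \<union> {c<..c + s}"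
  have mem_us: "x \<in> evens us \<longleftrightarrow> 0 \<le> x \<and> x < s" "x \<in> odds us \<longleftrightarrow> 0 \<le> x \<and> x < s"
    "x \<in> adj_sums us \<longleftrightarrow> 0 \<le> x \<and> x < 2 * s - 1" for x
    using alpha_pathD(3-5)[OF us(1)] by auto
  have ws_mem: "evens ws = R" "odds ws = R"
    unfolding set_eq_iff R_def ws_def vs_def using ev
    by (auto simp: walk_simps mem_simps mem_us)
  have ws_sums: "x \<in> adj_sums ws \<longleftrightarrow>
      - 2 * c - 2 * s \<le> x \<and> x \<le> - 2 * c - 2 \<or> x = 0 \<or> 2 * c + 2 \<le> x \<and> x \<le> 2 * c + 2 * s" for x
  proof -
    have "x \<in> adj_sums ws \<longleftrightarrow> x \<in> adj_sums vs \<or> x = 0 \<or> - x \<in> adj_sums vs"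
      using us_ne ev by (auto simp: ws_def vs_def walk_simps adj_sums_uminus)
    then show ?thesis
      unfolding vs_def adj_sums_shift mem_us by linarith
  qed
  have "evens (ps @ ws @ qs) = evens (ps @ qs) \<union> R" "odds (ps @ ws @ qs) = odds (ps @ qs) \<union> R"
    using ws ws_mem by (auto simp: evens_append odds_append)
  moreover have "adj_sums (ps @ ws @ qs) =
      adj_sums (ps @ qs) \<union> ({- 2 * (c + s)..2 * (c + s)} - {- 2 * c..2 * c})"
  proof -
    have "x \<in> adj_sums (ps @ ws @ qs) \<longleftrightarrow>
      x \<in> adj_sums (ps @ qs) \<or> - 2 * (c + s) \<le> x \<and> x \<le> 2 * (c + s) \<and> \<not> (- 2 * c \<le> x \<and> x \<le> 2 * c)" for x
    proof -
      have "x \<in> adj_sums (ps @ ws @ qs) \<longleftrightarrow>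
          x \<in> adj_sums ps \<or> x \<in> adj_sums qs \<or> x = - 2 * c - 1 \<or> x = 2 * c + 1 \<or> x \<in> adj_sums ws"
        using ne ws ends by (auto simp: adj_sums_append)
      moreover have "x \<in> adj_sums (ps @ qs) \<longleftrightarrow> x \<in> adj_sums ps \<or> x \<in> adj_sums qs \<or> x = 0"
        using ne ends by (auto simp: adj_sums_append)
      ultimately show ?thesis
        unfolding ws_sums using \<open>c \<ge> 0\<close> \<open>s > 0\<close> by auto
    qed
    then show ?thesis by (intro set_eqI) (simp only: Un_iff Diff_iff atLeastAtMost_iff conj_assoc)
  qed
  moreover have "length ws = 4 * nat s"
  proof -
    have "int (length us) = 2 * s" using us(1) by (simp add: alpha_path_def)
    then show ?thesis by (simp add: ws_def vs_def)
  qed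
  moreover have "{-c..c} \<union> R = {-(c + s)..c + s}"
    using \<open>c \<ge> 0\<close> \<open>s > 0\<close> by (auto simp: R_def)
  moreover have "{-2 * c..2 * c} \<union> ({- 2 * (c + s)..2 * (c + s)} - {- 2 * c..2 * c}) =
      {- 2 * (c + s)..2 * (c + s)}"
    using \<open>c \<ge> 0\<close> \<open>s > 0\<close> by auto
  ultimately have "centred_labelling (c + s) l (m + 4 * nat s) cs (ps @ ws @ qs)"
    using lab ne \<open>s > 0\<close> unfolding centred_labelling_def by (simp flip: Un_assoc)
  then show ?thesis by blast
qed

section \<open>From centred labelings to \<alpha>-labelings\<close>

definition label :: "int \<Rightarrow> nat \<Rightarrow> int \<Rightarrow> int" where
  "label k i x = (if even i then x + k else 3 * k + 1 - x)"

text \<open>Only surjectivity onto vertices and differences is read off from the lists; injectivity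
  follows by comparing cardinalities.\<close>

lemma centred_labelling_imp_is_AL:
  assumes lab: "centred_labelling k l m cs ps" and "l \<ge> 3"
  shows "\<exists>\<Gamma>. is_AL l m k (3 * k + 1) \<Gamma>"
proof -
  define f where "f v = (case v of Inl i \<Rightarrow> label k i (cs ! i) | Inr i \<Rightarrow> label k i (ps ! i))" for v
  define V where "V = verts (cycle_path l m)"
  define \<Gamma> :: "int ugraph" where "\<Gamma> = \<lparr> verts = f ` V, edges = (`) f ` edges (cycle_path l m) \<rparr>"
  \<comment> \<open>Every edge of the cycle or the path is indexed by its initial vertex
    \<open>j\<close>, its other end being \<open>nxt j\<close>.\<close>
  define J where "J = {..<l} <+> {..<m}"
  define nxt :: "nat + nat \<Rightarrow> nat + nat"
    where "nxt j = (case j of Inl i \<Rightarrow> Inl ((i + 1) mod l) | Inr i \<Rightarrow> Inr (i + 1))" for j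
  define pos :: "nat + nat \<Rightarrow> nat" where "pos j = (case j of Inl i \<Rightarrow> i | Inr i \<Rightarrow> i)" for j
  have par: "even l" "odd m" and card: "int (l + m) = 4 * k + 1"
    and len: "length cs = l" "length ps = m + 1"
    and ev: "evens cs \<union> evens ps = {-k..k}" and od: "odds cs \<union> odds ps = {-k..k}"
    and sums: "insert (last cs + hd cs) (adj_sums cs) \<union> adj_sums ps = {-2 * k..2 * k}"
    and ends: "hd ps = 0" "last ps = 0"
    using lab by (auto simp: centred_labelling_def)
  have V: "V = {..<l} <+> {..m}"
    by (simp add: V_def cycle_path_def disjoint_union_def cycle_graph_def path_graph_def)
  have "edges (cycle_path l m) = (\<lambda>j. {j, nxt j}) ` J"
    by (auto simp: cycle_path_def disjoint_union_def cycle_graph_def path_graph_def J_def nxt_def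
        image_Un image_image Plus_def setcompr_eq_image[of _ "\<lambda>i. i < _"] lessThan_def[symmetric])
  then have edges: "edges \<Gamma> = (\<lambda>j. {f j, f (nxt j)}) ` J"
    by (simp add: \<Gamma>_def image_image)
  \<comment> \<open>Since \<open>l\<close> is even, the closing edge of the cycle also joins
    positions of opposite parity.\<close>
  have J: "j \<in> V" "nxt j \<in> V" "even (pos (nxt j)) \<longleftrightarrow> odd (pos j)" if "j \<in> J" for j
    using that \<open>even l\<close> \<open>l \<ge> 3\<close> by (auto simp: J_def V nxt_def pos_def dvd_mod_iff)
  have f_even: "f v \<in> {0..2 * k}" if "v \<in> V" "even (pos v)" for v
  proof -
    have "f v - k \<in> evens cs \<union> evens ps"
      using that len by (auto simp: V f_def label_def pos_def evens_iff_nth less_Suc_eq_le)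
    then show ?thesis unfolding ev by auto
  qed
  have f_odd: "f v \<in> {2 * k + 1..4 * k + 1}" if "v \<in> V" "odd (pos v)" for v
  proof -
    have "3 * k + 1 - f v \<in> odds cs \<union> odds ps"
      using that len by (auto simp: V f_def label_def pos_def odds_iff_nth less_Suc_eq_le)
    then show ?thesis unfolding od by auto
  qed
  have fV: "f ` V = {0..int (l + m)}"
  proof (intro equalityI subsetI)
    fix x assume "x \<in> f ` V"
    then obtain v where "v \<in> V" "x = f v" by blast
    then show "x \<in> {0..int (l + m)}"
      unfolding card using f_even[of v] f_odd[of v] by (cases "even (pos v)") auto
  next
    fix x assume x: "x \<in> {0..int (l + m)}"
    show "x \<in> f ` V"
    proof (cases "x \<le> 2 * k")
      case True
      then have "x - k \<in> evens cs \<union> evens ps" using x unfolding ev by auto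
      then obtain v where "v \<in> V" "f v = x"
        using len by (force simp: V f_def label_def evens_iff_nth less_Suc_eq_le)
      then show ?thesis by blast
    next
      case False
      then have "3 * k + 1 - x \<in> odds cs \<union> odds ps" using x unfolding od card by auto
      then obtain v where "v \<in> V" "f v = x"
        using len by (force simp: V f_def label_def odds_iff_nth less_Suc_eq_le)
      then show ?thesis by blast
    qed
  qed
  have inj: "inj_on f V"
  proof (rule eq_card_imp_inj_on)
    show "finite V" by (simp add: V)
    have "card V = l + (m + 1)" by (simp add: V card_Plus)
    then show "card (f ` V) = card V" by (simp add: fV)
  qed
  have bip: "\<exists>a\<in>{0..(int (l + m) - 1) div 2}. \<exists>b\<in>{(int (l + m) + 1) div 2..int (l + m)}. e = {a, b}"
    if "e \<in> edges \<Gamma>" for e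
  proof -
    obtain j where j: "j \<in> J" "e = {f j, f (nxt j)}"
      using \<open>e \<in> edges \<Gamma>\<close> unfolding edges by blast
    have half: "(int (l + m) - 1) div 2 = 2 * k" "(int (l + m) + 1) div 2 = 2 * k + 1"
      unfolding card by simp_all
    show ?thesis
      unfolding half unfolding card
      using j(2) J[OF j(1)] f_even[of j] f_odd[of j] f_even[of "nxt j"] f_odd[of "nxt j"]
      by (cases "even (pos j)") (metis insert_commute)+
  qed
  define D where "D = {(x, y). {x, y} \<in> edges \<Gamma>}"
  have D: "D = (\<lambda>j. (f j, f (nxt j))) ` J \<union> (\<lambda>j. (f (nxt j), f j)) ` J"
    unfolding D_def edges by (auto simp: doubleton_eq_iff image_iff)
  let ?T = "{1..int (l + m)} \<union> uminus ` {1..int (l + m)}"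
  let ?d = "\<lambda>(x, y). x - y :: int"
  have finJ: "finite J" "card J = l + m" by (auto simp: J_def card_Plus)
  have finD: "finite D" "card D \<le> 2 * (l + m)"
  proof -
    show "finite D" unfolding D using finJ by simp
    have "card D \<le> card ((\<lambda>j. (f j, f (nxt j))) ` J) + card ((\<lambda>j. (f (nxt j), f j)) ` J)"
      unfolding D by (rule card_Un_le)
    also have "\<dots> \<le> card J + card J"
      using finJ by (intro add_mono card_image_le)
    finally show "card D \<le> 2 * (l + m)" using finJ by simp
  qed
  have cardT: "card ?T = 2 * (l + m)"
    by (subst card_Un_disjoint) (auto simp: card_image)
  have gap: "\<exists>j\<in>J. f j - f (nxt j) = d \<or> f (nxt j) - f j = d" if "d \<in> {1..int (l + m)}" for d
  proof -
    have "2 * k + 1 - d \<in> insert (last cs + hd cs) (adj_sums cs) \<union> adj_sums ps"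
      using that unfolding sums card by auto
    then consider "last cs + hd cs = 2 * k + 1 - d"
      | i where "Suc i < l" "cs ! i + cs ! Suc i = 2 * k + 1 - d"
      | i where "Suc i < m + 1" "ps ! i + ps ! Suc i = 2 * k + 1 - d"
      using len by (auto simp: adj_sums_iff_nth)
    then show ?thesis
    proof cases
      case 1
      have "cs \<noteq> []" using len \<open>l \<ge> 3\<close> by auto
      then have "last cs = cs ! (l - 1)" "hd cs = cs ! 0"
        using len by (simp_all add: last_conv_nth hd_conv_nth)
      then show ?thesis
        using 1 \<open>l \<ge> 3\<close> par
        by (intro bexI[of _ "Inl (l - 1)"]) (auto simp: f_def nxt_def label_def J_def)
    next
      case (2 i)
      then show ?thesis
        by (intro bexI[of _ "Inl i"]) (auto simp: f_def nxt_def label_def J_def)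
    next
      case (3 i)
      then show ?thesis
        by (intro bexI[of _ "Inr i"]) (auto simp: f_def nxt_def label_def J_def)
    qed
  qed
  have sub: "?T \<subseteq> ?d ` D"
  proof
    fix d assume "d \<in> ?T"
    then have "\<bar>d\<bar> \<in> {1..int (l + m)}" by auto
    from gap[OF this] obtain j where "j \<in> J" "f j - f (nxt j) = d \<or> f (nxt j) - f j = d"
      by fastforce
    then have "\<exists>u. u \<in> D \<and> d = ?d u"
      unfolding D by fastforce
    then show "d \<in> ?d ` D" by blast
  qed
  \<comment> \<open>At most 2(l + m) ordered pairs realise 2(l + m) differences, so each difference
    occurs once.\<close>
  have "card (?d ` D) \<le> card ?T"
    using card_image_le[OF finD(1), of ?d] finD(2) cardT by linarith
  then have T: "?d ` D = ?T"
    using card_seteq[OF _ sub] finD by auto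
  have "inj_on ?d D"
    using card_image_le[OF finD(1), of ?d] finD cardT unfolding T
    by (intro eq_card_imp_inj_on) (simp_all only: T)
  then have "image_mset ?d (mset_set D) = mset_set ?T"
    by (simp add: image_mset_mset_set T)
  then have diff: "difference_mset \<Gamma> = mset_set ?T"
    by (simp add: difference_mset_def D_def)
  have "graph_iso f (cycle_path l m) \<Gamma>"
    using inj by (simp add: graph_iso_def \<Gamma>_def V_def bij_betw_def)
  moreover have "{f (Inr 0), f (Inr m)} = {k, 3 * k + 1}"
  proof -
    have "ps \<noteq> []" using len by auto
    then have "ps ! 0 = 0" "ps ! m = 0"
      using ends len by (simp_all add: last_conv_nth hd_conv_nth)
    then show ?thesis using par by (simp add: f_def label_def)
  qed
  moreover have "verts \<Gamma> = {0..int (l + m)}" by (simp add: \<Gamma>_def fV)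
  ultimately have "is_AL l m k (3 * k + 1) \<Gamma>"
    unfolding is_AL_def Let_def using bip diff by (intro conjI exI[of _ f] ballI) simp_all
  then show ?thesis by blast
qed

section \<open>Constructions\<close>

text \<open>The first and third are seeds for extension with l = 4 and l = 6; the second and fourth
  are the next values of \<open>k\<close>, still too small for it. The others are the cases of m = 3
  below the general construction.\<close>

lemma centred_labelling_sporadic:
  "centred_labelling 3 4 9 [-3, -3, -2, -1] [0, -2, 2, 1, 1, 3, 3, 2, -1, 0]"
  "centred_labelling 4 4 13 [-2, -1, -1, 1] [0, -4, -4, -3, -3, -2, 4, 4, 3, 3, 2, 2, 1, 0]"
  "centred_labelling 4 6 11 [1, 1, 2, 4, 4, 3] [0, -1, -4, -4, -3, -3, 3, 2, -1, -2, -2, 0]"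
  "centred_labelling 5 6 15 [1, 3, 4, 4, 5, 5]
     [0, -1, -2, -2, -3, -3, -4, -4, -5, -5, 3, 2, -1, 1, 2, 0]"
  "centred_labelling 3 10 3 [-3, -3, -2, -2, -1, 3, 3, 2, 2, 1] [0, -1, 1, 0]"
  "centred_labelling 4 14 3 [-4, -4, -3, -3, -2, -2, -1, 3, 3, 4, 4, 1, 2, 2] [0, -1, 1, 0]"
  "centred_labelling 5 18 3 [5, 3, 3, 4, -2, -2, -1, -4, -5, -5, -3, -3, -4, 2, 2, 1, 4, 5]
     [0, -1, 1, 0]"
  by code_simp+

text \<open>The zigzag on the negative vertices has sums -2t..-2, the path on the positive ones
  2..2t. The start 1 of \<open>ys\<close> makes the link -1 + 2 = 1, and its end makes the closing
  edge (t - 1) - t = -1.\<close>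

lemma centred_labelling_path1:
  assumes "t \<ge> 2"
  shows "\<exists>cs. centred_labelling t (nat (4 * t)) 1 cs [0, 0]"
proof -
  obtain xs where xs: "alpha_path t t xs" "hd xs = 0" "last xs = t - 1"
    using zigzag_even[of t] assms by auto
  obtain ys where ys: "alpha_path t t ys" "hd ys = 1" "last ys = t - 2"
    using alpha_path_starting_at[of 2 t] assms by auto
  have ne: "xs \<noteq> []" "ys \<noteq> []" and ev: "even (length xs)" "even (length ys)"
    using xs ys assms alpha_path_nonempty alpha_path_length_parity[of t t] by auto
  define cs where "cs = shift (- t) (- t) xs @ shift 1 1 ys"
  have mem: "x \<in> evens cs \<longleftrightarrow> - t \<le> x \<and> x < 0 \<or> 0 < x \<and> x \<le> t"
    "x \<in> odds cs \<longleftrightarrow> - t \<le> x \<and> x < 0 \<or> 0 < x \<and> x \<le> t"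
    "x \<in> adj_sums cs \<longleftrightarrow> - 2 * t \<le> x \<and> x < - 1 \<or> x = 1 \<or> 1 < x \<and> x \<le> 2 * t" for x
    using alpha_pathD(3-5)[OF xs(1)] alpha_pathD(3-5)[OF ys(1)] xs(2,3) ys(2,3) ne ev
    by (auto simp: cs_def walk_simps mem_simps)
  have "int (length cs) = 4 * t"
    using xs(1) ys(1) by (simp add: cs_def alpha_path_def)
  then have "length cs = nat (4 * t)" by simp
  moreover have "hd cs = - t" "last cs = t - 1"
    using xs ys ne ev by (auto simp: cs_def walk_simps)
  ultimately have "centred_labelling t (nat (4 * t)) 1 cs [0, 0]"
    unfolding centred_labelling_def set_eq_iff using assms
    by (auto simp: mem even_nat_iff)
  then show ?thesis by blast
qed

lemma centred_labelling_path3: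
  assumes "c \<ge> 3"
  shows "\<exists>cs. centred_labelling c (nat (4 * c - 2)) 3 cs [0, -1, 1, 0]"
proof -
  have "c = 3 \<or> c = 4 \<or> c = 5 \<or> c \<ge> 6" using assms by presburger
  then consider "c = 3" | "c = 4" | "c = 5" | "c \<ge> 6" by blast
  then show ?thesis
  proof cases
    \<comment> \<open>The path 0, -1, 1, 0 uses the sums -1, 0, 1. The pieces \<open>xs\<close> and
      \<open>ys\<close> yield -2c..-3 and 3..2c, so the link and the closing edge must yield -2 and
      2; hence \<open>ys\<close> runs from 2 to c - 3. Starting \<open>vs\<close> at 2 requires 3
      \<le> c - 3.\<close>
    case 4
    obtain xs where xs: "alpha_path c (c - 1) xs" "hd xs = c - 1" "last xs = 0"
      using zigzag_odd_down[of "c - 1"] 4 by auto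
    obtain us where us: "alpha_path 3 2 us" "hd us = 2" "last us = 0"
      using zigzag_odd_down[of 2] by auto
    obtain vs where vs: "alpha_path (c - 3) (c - 3) vs" "hd vs = 2" "last vs = c - 6"
      using alpha_path_starting_at[of 3 "c - 3"] 4 by auto
    define ys where "ys = us @ shift 2 3 vs"
    have ys: "alpha_path c (c - 1) ys"
      using alpha_path_append_odd[of 2 us "c - 3" "c - 3" vs] us vs 4 by (simp add: ys_def)
    have ne: "xs \<noteq> []" "ys \<noteq> []" "us \<noteq> []" "vs \<noteq> []"
      using xs ys us vs 4 alpha_path_nonempty by auto
    have od: "odd (length xs)" "odd (length ys)" "even (length vs)"
      using xs ys vs alpha_path_length_parity[of c "c - 1"] alpha_path_length_parity[of "c - 3" "c - 3"]
      by auto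
    have ends: "hd ys = 2" "last ys = c - 3"
      using us vs ne od by (auto simp: ys_def walk_simps)
    define cs where "cs = shift (- c) (- c) xs @ shift c c (map uminus ys)"
    have mem: "x \<in> evens cs \<longleftrightarrow> - c \<le> x \<and> x < 0 \<or> 1 < x \<and> x \<le> c"
      "x \<in> odds cs \<longleftrightarrow> - c \<le> x \<and> x < - 1 \<or> 0 < x \<and> x \<le> c"
      "x \<in> adj_sums cs \<longleftrightarrow> - 2 * c \<le> x \<and> x < - 2 \<or> x = - 2 \<or> 2 < x \<and> x \<le> 2 * c" for x
      using alpha_pathD(3-5)[OF xs(1)] alpha_pathD(3-5)[OF ys(1)] xs(2,3) ends ne od
      by (auto simp: cs_def walk_simps mem_simps)
    have "int (length cs) = 4 * c - 2"
      using xs(1) ys(1) by (simp add: cs_def alpha_path_def)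
    then have "length cs = nat (4 * c - 2)" by simp
    moreover have "hd cs = - 1" "last cs = 3"
      using xs ends ne od by (auto simp: cs_def walk_simps)
    ultimately have "centred_labelling c (nat (4 * c - 2)) 3 cs [0, -1, 1, 0]"
      unfolding centred_labelling_def set_eq_iff using 4
      by (auto simp: mem even_nat_iff)
    then show ?thesis by blast
  qed (use centred_labelling_sporadic in auto)
qed

lemma centred_labelling_long_path:
  assumes "l \<ge> 4" "even l" "int (l + m) = 4 * k + 1" "m \<ge> l + 5"
  shows "\<exists>cs ps. centred_labelling k l m cs ps"
proof -
  have "l = 4 \<or> l = 6 \<or> (\<exists>t \<ge> 2. int l = 4 * t) \<or> (\<exists>c \<ge> 3. int l = 4 * c - 2)"
    using assms by presburger
  then consider "l = 4" | "l = 6" | t where "t \<ge> 2" "int l = 4 * t"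
    | c where "c \<ge> 3" "int l = 4 * c - 2"
    by blast
  then show ?thesis
  proof cases
    case 1
    then have "k = 3 \<and> m = 9 \<or> k = 4 \<and> m = 13 \<or> k \<ge> 5" using assms by presburger
    then consider "k = 3" "m = 9" | "k = 4" "m = 13" | "k \<ge> 5" by blast
    then show ?thesis
    proof cases
      case 3
      \<comment> \<open>The expanded edge joins -2 and 2, so the bound needed is 3 - 2 < k -
        3.\<close>
      have "9 + 4 * nat (k - 3) = m" using 1 3 assms by simp
      then show ?thesis
        using centred_labelling_extend[of 3 4 9 "[-3, -3, -2, -1]" "[0, -2]"
            "[2, 1, 1, 3, 3, 2, -1, 0]" "-2" "k - 3"]
          centred_labelling_sporadic(1) 1 3 by auto
    qed (use 1 centred_labelling_sporadic in blast)+
  next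
    case 2
    then have "k = 4 \<and> m = 11 \<or> k = 5 \<and> m = 15 \<or> k \<ge> 6" using assms by presburger
    then consider "k = 4" "m = 11" | "k = 5" "m = 15" | "k \<ge> 6" by blast
    then show ?thesis
    proof cases
      case 3
      have "11 + 4 * nat (k - 4) = m" using 2 3 assms by simp
      then show ?thesis
        using centred_labelling_extend[of 4 6 11 "[1, 1, 2, 4, 4, 3]" "[0, -1, -4, -4, -3, -3]"
            "[3, 2, -1, -2, -2, 0]" "-3" "k - 4"]
          centred_labelling_sporadic(3) 2 3 by auto
    qed (use 2 centred_labelling_sporadic in blast)+
  next
    case (3 t)
    then obtain cs where "centred_labelling t (nat (4 * t)) 1 cs [0, 0]"
      using centred_labelling_path1 by blast
    \<comment> \<open>The bound t < k - t is m \<ge> l + 5 rewritten; for l = 4c - 2 below, the edge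
      from -1 to 1 gives the same threshold.\<close>
    moreover have "nat (4 * t) = l" "1 + 4 * nat (k - t) = m" "t + 0 < k - t"
      using 3 assms by linarith+
    ultimately show ?thesis
      using centred_labelling_extend[of t l 1 cs "[0]" "[0]" 0 "k - t"] 3 by auto
  next
    case (4 c)
    then obtain cs where "centred_labelling c (nat (4 * c - 2)) 3 cs [0, -1, 1, 0]"
      using centred_labelling_path3 by blast
    moreover have "nat (4 * c - 2) = l" "3 + 4 * nat (k - c) = m" "c - 1 < k - c"
      using 4 assms by linarith+
    ultimately show ?thesis
      using centred_labelling_extend[of c l 3 cs "[0, -1]" "[1, 0]" "-1" "k - c"] 4 by auto
  qed
qed

theorem theorem4p6:
  fixes l m :: nat
  assumes "l \<ge> 4" and "even l"
    and "m \<ge> 1" and "odd m"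
    and "[l + m = 1] (mod 4)"
    and "(m \<in> {1, 3} \<and> l \<ge> 8) \<or> m \<ge> l + 5"
  shows "\<exists>\<Gamma>. is_AL l m (int ((l + m - 1) div 4)) (3 * int ((l + m - 1) div 4) + 1) \<Gamma>"
proof -
  define k where "k = int ((l + m - 1) div 4)"
  have "(l + m) mod 4 = 1" using assms(5) by (simp add: cong_def)
  then have k: "int (l + m) = 4 * k + 1" unfolding k_def by presburger
  have "\<exists>cs ps. centred_labelling k l m cs ps"
  proof (cases "m \<ge> l + 5")
    case True
    then show ?thesis using centred_labelling_long_path assms(1,2) k by blast
  next
    case False
    \<comment> \<open>Here l \<ge> 8 gives k \<ge> 2 from l = 4k, and k \<ge> 3 from l = 4k -
      2.\<close>
    then have "m = 1 \<and> nat (4 * k) = l \<and> k \<ge> 2 \<or> m = 3 \<and> nat (4 * k - 2) = l \<and> k \<ge> 3"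
      using assms(6) k by auto
    then show ?thesis
      using centred_labelling_path1[of k] centred_labelling_path3[of k] by auto
  qed
  then show ?thesis
    using centred_labelling_imp_is_AL[of k l m] \<open>l \<ge> 4\<close> unfolding k_def[symmetric] by auto
qed

end
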